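(* Consider the $g$-partial gathering problem for $k$ mobile agents in synchronous 1-interval connected (dynamic) bidirectional rings of $n$ nodes, in the model described in the context. Any algorithm solving this problem requires $\Omega(n)$ rounds in the worst case; that is, a lower bound on the time complexity of the $g$-partial gathering problem in dynamic rings is $\Omega(n)$.
   Context: Model. A dynamic bidirectional ring has anonymous nodes $v_0,\dots,v_{n-1}$ and links $e_i=\{v_i,v_{i+1 \bmod n}\}$; in each round an adversary may make at most one link missing (1-interval connectivity). Each node has a whiteboard that agents located there can read and write. There are $k\le n$ agents, which are deterministic finite automata with distinct IDs, knowledge of $n$ and $k$, and chirality (a common notion of forward $v_i\to v_{i+1}$ and backward $v_i\to v_{i-1}$). Agents cannot directly detect other agents at their node. Initially agents occupy pairwise distinct nodes, and a node's whiteboard is initially in one of two special states according to whether an agent starts there. Execution is fully synchronous: in each round every agent atomically reads the whiteboard, changes state, writes the whiteboard, and either stays or tries to move to a neighbouring node; if the link it tries to traverse is missing in that round it is blocked and stays. An agent terminates by entering a final state, after which it never acts. Problem. For a given positive integer $g<k$, an algorithm solves the $g$-partial gathering problem if every execution is finite (all agents terminate) and in the final configuration every node hosting at least one agent hosts at least $g$ agents. Time complexity is the number of rounds until the problem is solved.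
   Formalization: The lower bound is stated for g ≥ 2 only; for g = 1 every configuration is already partially gathered, so agents that terminate at once solve the problem in one round and the Ω(n) bound fails. *)

theory Defs
  imports Complex_Main "HOL-Library.Extended_Real"
begin

datatype move = Forward | Stay | Backward

text \<open>
  The agent with identifier \<open>i\<close> is the automaton with transition function \<open>delta A i\<close>, mapping the
  current state and the contents of the whiteboard to the next state, the new contents and the
  attempted move.  The ring size and the number of agents are known to the agents, so an algorithm
  is an object for one fixed pair \<open>n\<close>, \<open>k\<close>.
\<close>

record ('s, 'w) algorithm =
  delta :: "nat \<Rightarrow> 's \<Rightarrow> 'w \<Rightarrow> 's \<times> 'w \<times> move"
  s_init :: 's
  s_final :: 's
  w_empty :: 'w
  w_home :: 'w

text \<open>
  Identifiers are arbitrary natural numbers.  A whiteboard has to be able to hold identifiers, so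
  finiteness is required of the states and contents used by any finite collection of agents, not
  uniformly over all potential identifiers (which would make almost all agents indistinguishable).
\<close>

definition finite_automata :: "('s, 'w) algorithm \<Rightarrow> bool" where
  "finite_automata A \<longleftrightarrow>
     s_init A \<noteq> s_final A \<and> w_empty A \<noteq> w_home A \<and>
     (\<forall>I. finite I \<longrightarrow>
       (\<exists>S W. finite S \<and> finite W \<and> {s_init A, s_final A} \<subseteq> S \<and> {w_empty A, w_home A} \<subseteq> W \<and>
         (\<forall>i\<in>I. \<forall>s\<in>S. \<forall>w\<in>W. delta A i s w \<in> S \<times> W \<times> UNIV)))"

text \<open>
  Nodes are \<open>0, \<dots>, n - 1\<close> and agents are \<open>0, \<dots>, k - 1\<close>; agents only have access to their
  identifiers, never to these indices.
\<close>

record ('s, 'w) config =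
  pos :: "nat \<Rightarrow> nat"
  st :: "nat \<Rightarrow> 's"
  wb :: "nat \<Rightarrow> 'w"

text \<open>Link \<open>e\<close> joins the nodes \<open>e\<close> and \<open>(e + 1) mod n\<close>; \<open>None\<close> means that no link is missing.\<close>

fun destination :: "nat \<Rightarrow> nat option \<Rightarrow> move \<Rightarrow> nat \<Rightarrow> nat" where
  "destination n missing Stay v = v"
| "destination n missing Forward v = (if missing = Some v then v else (v + 1) mod n)"
| "destination n missing Backward v =
     (let u = (v + n - 1) mod n in if missing = Some u then v else u)"

definition act ::
  "nat \<Rightarrow> ('s, 'w) algorithm \<Rightarrow> (nat \<Rightarrow> nat) \<Rightarrow> nat option \<Rightarrow> nat \<Rightarrow>
     ('s, 'w) config \<Rightarrow> ('s, 'w) config" where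
  "act n A ids missing a C =
     (if st C a = s_final A then C
      else case delta A (ids a) (st C a) (wb C (pos C a)) of (s, w, d) \<Rightarrow>
        \<lparr>pos = (pos C)(a := destination n missing d (pos C a)),
         st = (st C)(a := s),
         wb = (wb C)(pos C a := w)\<rparr>)"

text \<open>
  A schedule gives, for each round, the missing link and the order in which agents sharing a node
  perform their atomic operations.  Since every agent acts once per round, at the node where it was
  at the beginning of the round, the relative order of agents at different nodes is immaterial.
\<close>

type_synonym schedule = "nat \<Rightarrow> nat option \<times> nat list"

definition valid_schedule :: "nat \<Rightarrow> nat \<Rightarrow> schedule \<Rightarrow> bool" where
  "valid_schedule n k \<sigma> \<longleftrightarrow>
     (\<forall>t. (\<forall>e. fst (\<sigma> t) = Some e \<longrightarrow> e < n) \<and>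
          distinct (snd (\<sigma> t)) \<and> set (snd (\<sigma> t)) = {..<k})"

definition init_config :: "nat \<Rightarrow> ('s, 'w) algorithm \<Rightarrow> (nat \<Rightarrow> nat) \<Rightarrow> ('s, 'w) config" where
  "init_config k A start =
     \<lparr>pos = start,
      st = (\<lambda>a. s_init A),
      wb = (\<lambda>v. if v \<in> start ` {..<k} then w_home A else w_empty A)\<rparr>"

primrec config_at ::
  "nat \<Rightarrow> nat \<Rightarrow> ('s, 'w) algorithm \<Rightarrow> (nat \<Rightarrow> nat) \<Rightarrow> (nat \<Rightarrow> nat) \<Rightarrow> schedule \<Rightarrow> nat \<Rightarrow>
     ('s, 'w) config" where
  "config_at n k A start ids \<sigma> 0 = init_config k A start"
| "config_at n k A start ids \<sigma> (Suc t) =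
     fold (act n A ids (fst (\<sigma> t))) (snd (\<sigma> t)) (config_at n k A start ids \<sigma> t)"

definition scenarios :: "nat \<Rightarrow> nat \<Rightarrow> ((nat \<Rightarrow> nat) \<times> (nat \<Rightarrow> nat) \<times> schedule) set" where
  "scenarios n k =
     {(start, ids, \<sigma>).
        start ` {..<k} \<subseteq> {..<n} \<and> inj_on start {..<k} \<and> inj_on ids {..<k} \<and> valid_schedule n k \<sigma>}"

definition all_terminated :: "nat \<Rightarrow> ('s, 'w) algorithm \<Rightarrow> ('s, 'w) config \<Rightarrow> bool" where
  "all_terminated k A C \<longleftrightarrow> (\<forall>a<k. st C a = s_final A)"

definition partially_gathered :: "nat \<Rightarrow> nat \<Rightarrow> nat \<Rightarrow> ('s, 'w) config \<Rightarrow> bool" where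
  "partially_gathered g n k C \<longleftrightarrow>
     (\<forall>v<n. (\<exists>a<k. pos C a = v) \<longrightarrow> g \<le> card {a. a < k \<and> pos C a = v})"

definition solves_partial_gathering :: "nat \<Rightarrow> nat \<Rightarrow> nat \<Rightarrow> ('s, 'w) algorithm \<Rightarrow> bool" where
  "solves_partial_gathering g n k A \<longleftrightarrow>
     (\<forall>(start, ids, \<sigma>) \<in> scenarios n k.
        \<exists>t. all_terminated k A (config_at n k A start ids \<sigma> t) \<and>
            partially_gathered g n k (config_at n k A start ids \<sigma> t))"

text \<open>Once all agents have terminated the configuration does not change any more.\<close>

definition rounds ::
  "nat \<Rightarrow> nat \<Rightarrow> ('s, 'w) algorithm \<Rightarrow> (nat \<Rightarrow> nat) \<Rightarrow> (nat \<Rightarrow> nat) \<Rightarrow> schedule \<Rightarrow> nat" where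
  "rounds n k A start ids \<sigma> = (LEAST t. all_terminated k A (config_at n k A start ids \<sigma> t))"

definition time_complexity :: "nat \<Rightarrow> nat \<Rightarrow> ('s, 'w) algorithm \<Rightarrow> enat" where
  "time_complexity n k A = (SUP (start, ids, \<sigma>) \<in> scenarios n k. enat (rounds n k A start ids \<sigma>))"

end

theory Submission
  imports Defs "HOL-Library.Ramsey"
begin

text \<open>
  No missing link is needed for the lower bound. Let \<open>T\<close> be the running time. Agents that end at the
  same node start at distance at most \<open>2 T\<close>.

  If one agent starts in the middle of the arc left free by the others, it is at distance about
  \<open>(n - k) / 2\<close> from them and has to meet one of them, whence \<open>n \<le> k + 4 T\<close>.

  To bound \<open>k\<close>, let the agents start at the nodes \<open>0, \<dots>, k - 1\<close>. Since identifiers are arbitrary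
  naturals, Ramsey's theorem yields an infinite set of identifiers on which the final positions do
  not depend on the \<open>k\<close> identifiers chosen, as long as they increase along the ring. If \<open>h\<close>
  enumerates this set, the runs with identifiers \<open>h 0, \<dots>, h (k - 1)\<close> and \<open>h r, \<dots>, h (k + r - 1)\<close>
  look the same up to a shift by \<open>r\<close> nodes except near the two ends, because information travels one
  node per round. So agents far from both ends are all displaced by the same amount and do not meet,
  although an agent in the middle only has such agents within distance \<open>2 T\<close> unless \<open>k \<le> 8 T + 2\<close>.
\<close>

section \<open>Distances and moves on the ring\<close>

definition ring_dist :: "nat \<Rightarrow> nat \<Rightarrow> nat \<Rightarrow> int" where
  "ring_dist n u v = min \<bar>int u - int v\<bar> (int n - \<bar>int u - int v\<bar>)"

lemma ring_dist_commute: "ring_dist n u v = ring_dist n v u"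
  by (simp add: ring_dist_def abs_minus_commute)

lemma ring_dist_triangle:
  assumes "u < n" "v < n" "w < n"
  shows "ring_dist n u w \<le> ring_dist n u v + ring_dist n v w"
  using assms by (auto simp: ring_dist_def min_def abs_if)

lemma ring_dist_interior:
  assumes "ring_dist n u v \<le> int t" "v < n" "t \<le> u" "u + t < n"
  shows "u \<le> v + t" "v \<le> u + t"
  using assms unfolding ring_dist_def by linarith+

lemma pred_mod: "v < n \<Longrightarrow> (v + n - Suc 0) mod n = (if v = 0 then n - 1 else v - 1)"
  using mod_add_self2[of "v - 1" n] by (cases v) auto

lemma destination_less: "v < n \<Longrightarrow> destination n m d v < n"
  by (cases d) (auto simp: Let_def)

lemma ring_dist_destination: "v < n \<Longrightarrow> ring_dist n v (destination n m d v) \<le> 1"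
  by (cases d) (auto simp: Let_def mod_Suc pred_mod ring_dist_def)

lemma destination_interior:
  assumes "v < n" "0 < destination n m d v" "destination n m d v + 1 < n"
  shows "destination n m d v \<le> v + 1" "v \<le> destination n m d v + 1"
  using ring_dist_destination[OF assms(1), of m d] assms ring_dist_interior[of n _ v 1]
  by (auto simp: ring_dist_commute)

abbreviation shift_link :: "nat \<Rightarrow> nat option \<Rightarrow> nat option" where
  "shift_link r \<equiv> map_option (\<lambda>e. e + r)"

lemma destination_shift:
  assumes "0 < v" "v + r + 1 < n"
  shows "destination n (shift_link r m) d (v + r) = destination n m d v + r"
  using assms by (cases d; cases m) (auto simp: Let_def pred_mod)

section \<open>Single rounds\<close>

lemma act_other [simp]:
  assumes "b \<noteq> a"
  shows "pos (act n A ids m a C) b = pos C b" "st (act n A ids m a C) b = st C b"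
  using assms by (auto simp: act_def split: prod.splits)

lemma wb_act_other [simp]:
  assumes "v \<noteq> pos C a"
  shows "wb (act n A ids m a C) v = wb C v"
  using assms by (auto simp: act_def split: prod.splits)

lemma fold_act_other [simp]:
  assumes "b \<notin> set xs"
  shows "pos (fold (act n A ids m) xs C) b = pos C b" "st (fold (act n A ids m) xs C) b = st C b"
  using assms by (induction xs arbitrary: C) auto

lemma pos_act: "\<exists>d. pos (act n A ids m a C) a = destination n m d (pos C a)"
proof (cases "st C a = s_final A")
  case True
  then show ?thesis by (intro exI[of _ Stay]) (simp add: act_def)
qed (auto simp: act_def split: prod.splits)

lemma pos_fold_act:
  assumes "distinct xs"
  shows "\<exists>d. pos (fold (act n A ids m) xs C) a = destination n m d (pos C a)"
  using assms
proof (induction xs arbitrary: C)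
  case Nil
  show ?case by (intro exI[of _ Stay]) simp
next
  case (Cons b xs)
  show ?case
  proof (cases "a = b")
    case True
    then show ?thesis using Cons.prems pos_act by simp
  next
    case False
    then show ?thesis using Cons.IH[of "act n A ids m b C"] Cons.prems by simp
  qed
qed

lemma pos_fold_act_interior:
  assumes "distinct xs" "pos C a < n"
    and "0 < pos (fold (act n A ids m) xs C) a" "pos (fold (act n A ids m) xs C) a + 1 < n"
  shows "pos (fold (act n A ids m) xs C) a \<le> pos C a + 1"
    and "pos C a \<le> pos (fold (act n A ids m) xs C) a + 1"
  using assms pos_fold_act[OF assms(1), of n A ids m C a] destination_interior[OF assms(2)] by metis+

lemma act_commute:
  assumes "a \<noteq> b" "pos C a \<noteq> pos C b"
  shows "act n A ids m a (act n A ids m b C) = act n A ids m b (act n A ids m a C)"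
  using assms by (auto simp: act_def fun_upd_twist split: prod.splits)

lemma fold_act_commute:
  assumes "b \<notin> set xs" "distinct xs" "\<forall>a\<in>set xs. pos C a \<noteq> pos C b"
  shows "fold (act n A ids m) xs (act n A ids m b C) = act n A ids m b (fold (act n A ids m) xs C)"
  using assms
proof (induction xs arbitrary: C)
  case (Cons a xs)
  have "pos (act n A ids m a C) c = pos C c" if "c \<in> insert b (set xs)" for c
    using that Cons.prems by (intro act_other) auto
  then have "fold (act n A ids m) xs (act n A ids m b (act n A ids m a C)) =
      act n A ids m b (fold (act n A ids m) xs (act n A ids m a C))"
    using Cons.prems by (intro Cons.IH) auto
  moreover have "act n A ids m a (act n A ids m b C) = act n A ids m b (act n A ids m a C)"
    using Cons.prems by (intro act_commute) auto
  ultimately show ?case by simp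
qed simp

lemma fold_act_local:
  fixes n A ids m
  defines "run \<equiv> fold (act n A ids m)"
  assumes "distinct xs"
  shows "wb (run xs C) v = wb (run [a\<leftarrow>xs. pos C a = v] C) v \<and>
    (\<forall>a. pos C a = v \<longrightarrow> pos (run xs C) a = pos (run [a\<leftarrow>xs. pos C a = v] C) a \<and>
      st (run xs C) a = st (run [a\<leftarrow>xs. pos C a = v] C) a)"
  using assms(2)
proof (induction xs arbitrary: C)
  case (Cons b xs)
  let ?C = "act n A ids m b C" and ?ys = "[a\<leftarrow>xs. pos C a = v]"
  have "pos ?C a = pos C a" if "a \<in> set xs" for a
    using that Cons.prems by (intro act_other) auto
  then have "[a\<leftarrow>xs. pos ?C a = v] = ?ys" by (intro filter_cong) auto
  then have IH: "wb (run xs ?C) v = wb (run ?ys ?C) v"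
    "pos ?C a = v \<Longrightarrow> pos (run xs ?C) a = pos (run ?ys ?C) a \<and>
      st (run xs ?C) a = st (run ?ys ?C) a" for a
    using Cons.IH[of ?C] Cons.prems by auto
  have agents: "pos (run xs ?C) a = pos (run ?ys ?C) a \<and> st (run xs ?C) a = st (run ?ys ?C) a"
    if "pos C a = v" for a
    using IH(2)[of a] that Cons.prems by (cases "a = b") (auto simp: run_def)
  show ?case
  proof (cases "pos C b = v")
    case True
    then show ?thesis using IH(1) agents by (simp add: run_def)
  next
    case False
    then have "run ?ys ?C = act n A ids m b (run ?ys C)"
      unfolding run_def using Cons.prems by (intro fold_act_commute) auto
    moreover have "pos (run ?ys C) b \<noteq> v" using Cons.prems False by (simp add: run_def)
    moreover have "a \<noteq> b" if "pos C a = v" for a using that False by blast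
    ultimately show ?thesis using IH(1) agents False by (auto simp: run_def)
  qed
qed (simp add: run_def)

section \<open>Executions\<close>

lemma pos_config_at_Suc:
  assumes "valid_schedule n k \<sigma>"
  shows "\<exists>d. pos (config_at n k A start ids \<sigma> (Suc t)) a =
    destination n (fst (\<sigma> t)) d (pos (config_at n k A start ids \<sigma> t) a)"
  using pos_fold_act[of "snd (\<sigma> t)"] assms by (simp add: valid_schedule_def)

lemma pos_config_at_less:
  assumes "valid_schedule n k \<sigma>" "start a < n"
  shows "pos (config_at n k A start ids \<sigma> t) a < n"
proof (induction t)
  case 0
  show ?case using assms(2) by (simp add: init_config_def)
next
  case (Suc t)
  then show ?case using pos_config_at_Suc[OF assms(1)] destination_less by metis
qed

lemma ring_dist_config_at:
  assumes "valid_schedule n k \<sigma>" "start a < n"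
  shows "ring_dist n (start a) (pos (config_at n k A start ids \<sigma> t) a) \<le> int t"
proof (induction t)
  case 0
  show ?case using assms(2) by (simp add: init_config_def ring_dist_def)
next
  case (Suc t)
  let ?p = "\<lambda>t. pos (config_at n k A start ids \<sigma> t) a"
  have less: "?p u < n" for u using assms by (rule pos_config_at_less)
  have "ring_dist n (start a) (?p (Suc t)) \<le>
      ring_dist n (start a) (?p t) + ring_dist n (?p t) (?p (Suc t))"
    using assms(2) less less by (rule ring_dist_triangle)
  also have "ring_dist n (?p t) (?p (Suc t)) \<le> 1"
    using pos_config_at_Suc[OF assms(1)] ring_dist_destination[OF less] by metis
  finally show ?case using Suc by simp
qed

lemma config_at_ids_cong:
  assumes "valid_schedule n k \<sigma>" "\<And>a. a < k \<Longrightarrow> ids a = ids' a"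
  shows "config_at n k A start ids \<sigma> t = config_at n k A start ids' \<sigma> t"
proof (induction t)
  case (Suc t)
  have "fold (act n A ids m) (snd (\<sigma> t)) C = fold (act n A ids' m) (snd (\<sigma> t)) C" for m C
    using assms by (intro fold_cong) (auto simp: valid_schedule_def act_def fun_eq_iff)
  then show ?case using Suc by simp
qed simp

lemma config_at_all_terminated:
  assumes "valid_schedule n k \<sigma>" "all_terminated k A (config_at n k A start ids \<sigma> t)" "t \<le> u"
  shows "config_at n k A start ids \<sigma> u = config_at n k A start ids \<sigma> t"
  using assms(3)
proof (induction u rule: dec_induct)
  case (step u)
  have "fold (act n A ids m) xs C = C" if "all_terminated k A C" "set xs \<subseteq> {..<k}" for xs C m
    using that by (induction xs) (auto simp: act_def all_terminated_def)
  then show ?case using step assms by (auto simp: valid_schedule_def)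
qed simp

lemma partially_gathered_at_time_complexity:
  assumes "solves_partial_gathering g n k A" "time_complexity n k A \<le> enat T"
    and scenario: "(start, ids, \<sigma>) \<in> scenarios n k"
  shows "partially_gathered g n k (config_at n k A start ids \<sigma> T)"
proof -
  let ?C = "config_at n k A start ids \<sigma>" and ?r = "rounds n k A start ids \<sigma>"
  obtain t where t: "all_terminated k A (?C t)" "partially_gathered g n k (?C t)"
    using assms(1) scenario by (fastforce simp: solves_partial_gathering_def)
  have "enat ?r \<le> time_complexity n k A"
    unfolding time_complexity_def using scenario by (rule SUP_upper2) simp
  then have "?r \<le> T" using assms(2) order_trans by fastforce
  moreover have "all_terminated k A (?C ?r)" "?r \<le> t"
    unfolding rounds_def using t(1) by (rule LeastI, rule Least_le)
  moreover have "valid_schedule n k \<sigma>" using scenario by (simp add: scenarios_def)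
  ultimately have "?C T = ?C t" using config_at_all_terminated by metis
  then show ?thesis using t(2) by simp
qed

lemma partially_gathered_shares_node:
  assumes "partially_gathered g n k C" "1 < g" "a < k" "pos C a < n"
  obtains b where "b < k" "b \<noteq> a" "pos C b = pos C a"
proof -
  have "{b. b < k \<and> pos C b = pos C a} \<noteq> {a}"
    using assms unfolding partially_gathered_def by fastforce
  then show ?thesis using that assms(3) by blast
qed

lemma agent_meets_nearby_agent:
  assumes "solves_partial_gathering g n k A" "1 < g" "time_complexity n k A \<le> enat T"
    and scenario: "(start, ids, \<sigma>) \<in> scenarios n k" and "a < k"
  obtains b where "b < k" "b \<noteq> a" "ring_dist n (start a) (start b) \<le> 2 * int T"
    "pos (config_at n k A start ids \<sigma> T) b = pos (config_at n k A start ids \<sigma> T) a"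
proof -
  let ?p = "pos (config_at n k A start ids \<sigma> T)"
  have valid: "valid_schedule n k \<sigma>" using scenario by (simp add: scenarios_def)
  have start: "start c < n" if "c < k" for c
    using scenario that by (auto simp: scenarios_def)
  have pos: "?p c < n" "ring_dist n (start c) (?p c) \<le> int T" if "c < k" for c
    using valid start[OF that] by (rule pos_config_at_less, rule ring_dist_config_at)
  obtain b where b: "b < k" "b \<noteq> a" "?p b = ?p a"
    using partially_gathered_at_time_complexity[OF assms(1,3) scenario] \<open>1 < g\<close> \<open>a < k\<close> pos(1)
    by (metis partially_gathered_shares_node)
  have "ring_dist n (start a) (start b) \<le>
      ring_dist n (start a) (?p a) + ring_dist n (?p b) (start b)"
    using ring_dist_triangle start pos(1) b \<open>a < k\<close> by metis
  also have "\<dots> \<le> 2 * int T"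
    using pos(2)[of a] pos(2)[of b] b(1) \<open>a < k\<close> by (simp add: ring_dist_commute)
  finally show ?thesis using that b by blast
qed

definition lossless_schedule :: "nat \<Rightarrow> schedule" where
  "lossless_schedule k = (\<lambda>t. (None, [0..<k]))"

lemma valid_lossless_schedule [simp]: "valid_schedule n k (lossless_schedule k)"
  by (auto simp: lossless_schedule_def valid_schedule_def)

lemma nodes_le_agents_plus_time:
  assumes "solves_partial_gathering g n k A" "1 < g" "time_complexity n k A \<le> enat T" "0 < k"
  shows "n \<le> k + 4 * T"
proof (cases "k < n")
  case True
  define start where "start = (id :: nat \<Rightarrow> nat)(0 := (n + k) div 2)"
  have "(start, id, lossless_schedule k) \<in> scenarios n k"
    using True by (auto simp: scenarios_def start_def inj_on_def)
  then obtain b where "b < k" "b \<noteq> 0" "ring_dist n (start 0) (start b) \<le> 2 * int T"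
    using agent_meets_nearby_agent assms by metis
  then show ?thesis
    using True unfolding ring_dist_def start_def by auto
qed simp

section \<open>Shifted configurations\<close>

abbreviation full_round ::
  "nat \<Rightarrow> nat \<Rightarrow> ('s, 'w) algorithm \<Rightarrow> (nat \<Rightarrow> nat) \<Rightarrow> nat option \<Rightarrow>
     ('s, 'w) config \<Rightarrow> ('s, 'w) config" where
  "full_round n k A ids m \<equiv> fold (act n A ids m) [0..<k]"

definition agents_at :: "nat \<Rightarrow> ('s, 'w) config \<Rightarrow> nat \<Rightarrow> nat set" where
  "agents_at k C v = {a. a < k \<and> pos C a = v}"

definition agent_shifted :: "nat \<Rightarrow> ('s, 'w) config \<Rightarrow> ('s, 'w) config \<Rightarrow> nat \<Rightarrow> bool" where
  "agent_shifted r C D j \<longleftrightarrow> pos C (j + r) = pos D j + r \<and> st C (j + r) = st D j"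

definition node_shifted :: "nat \<Rightarrow> nat \<Rightarrow> ('s, 'w) config \<Rightarrow> ('s, 'w) config \<Rightarrow> nat \<Rightarrow> bool" where
  "node_shifted k r C D v \<longleftrightarrow>
     wb C (v + r) = wb D v \<and>
     agents_at k C (v + r) = (\<lambda>j. j + r) ` agents_at k D v \<and>
     (\<forall>j\<in>agents_at k D v. agent_shifted r C D j)"

lemma act_shifted:
  assumes "0 < v" "v + r + 1 < n"
    and "wb C (v + r) = wb D v" "pos D j = v" "agent_shifted r C D j" "ids (j + r) = ids' j"
  shows "wb (act n A ids (shift_link r m) (j + r) C) (v + r) = wb (act n A ids' m j D) v"
    and "agent_shifted r (act n A ids (shift_link r m) (j + r) C) (act n A ids' m j D) j"
  using assms destination_shift[OF assms(1,2)]
  by (auto simp: agent_shifted_def act_def split: prod.splits)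

lemma fold_act_shifted:
  fixes n A ids ids' m r
  defines "run \<equiv> fold (act n A ids (shift_link r m))" and "run' \<equiv> fold (act n A ids' m)"
  assumes v: "0 < v" "v + r + 1 < n" and "distinct xs" "wb C (v + r) = wb D v"
    and "\<forall>j\<in>set xs. pos D j = v \<and> agent_shifted r C D j \<and> ids (j + r) = ids' j"
  shows "wb (run (map (\<lambda>j. j + r) xs) C) (v + r) = wb (run' xs D) v \<and>
    (\<forall>j\<in>set xs. agent_shifted r (run (map (\<lambda>j. j + r) xs) C) (run' xs D) j)"
  using assms(5-)
proof (induction xs arbitrary: C D)
  case (Cons i xs)
  let ?C = "act n A ids (shift_link r m) (i + r) C" and ?D = "act n A ids' m i D"
  have act: "wb ?C (v + r) = wb ?D v" "agent_shifted r ?C ?D i"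
    using Cons.prems v by (auto intro!: act_shifted)
  have "pos ?D j = v \<and> agent_shifted r ?C ?D j \<and> ids (j + r) = ids' j" if "j \<in> set xs" for j
  proof -
    have "j \<noteq> i" using that Cons.prems(1) by auto
    then show ?thesis using that Cons.prems(3) by (simp add: agent_shifted_def)
  qed
  then have "wb (run (map (\<lambda>j. j + r) xs) ?C) (v + r) = wb (run' xs ?D) v \<and>
    (\<forall>j\<in>set xs. agent_shifted r (run (map (\<lambda>j. j + r) xs) ?C) (run' xs ?D) j)"
    using Cons.prems(1) act(1) by (intro Cons.IH) auto
  moreover have "i \<notin> set xs" "i + r \<notin> set (map (\<lambda>j. j + r) xs)" using Cons.prems(1) by auto
  then have "agent_shifted r (run (map (\<lambda>j. j + r) xs) ?C) (run' xs ?D) i"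
    using act(2) unfolding agent_shifted_def run_def run'_def by (metis fold_act_other)
  ultimately show ?case by (simp add: run_def run'_def)
qed (simp add: run_def run'_def)

lemma round_shifted:
  fixes n A ids ids' m r k C D
  defines "C' \<equiv> full_round n k A ids (shift_link r m) C"
    and "D' \<equiv> full_round n k A ids' m D"
  assumes v: "0 < v" "v + r + 1 < n"
    and shifted: "node_shifted k r C D v" and ids: "\<forall>j. j + r < k \<longrightarrow> ids (j + r) = ids' j"
  shows "wb C' (v + r) = wb D' v" and "j \<in> agents_at k D v \<Longrightarrow> agent_shifted r C' D' j"
proof -
  define xs where "xs = [j\<leftarrow>[0..<k]. pos D j = v]"
  have xs: "set xs = agents_at k D v" "distinct xs" by (auto simp: xs_def agents_at_def)
  have "set [a\<leftarrow>[0..<k]. pos C a = v + r] = agents_at k C (v + r)"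
    by (auto simp: agents_at_def)
  also have "\<dots> = set (map (\<lambda>j. j + r) xs)"
    using shifted by (simp add: node_shifted_def xs)
  moreover have "sorted xs" unfolding xs_def by (intro sorted_wrt_filter sorted_upt)
  ultimately have filter_C: "[a\<leftarrow>[0..<k]. pos C a = v + r] = map (\<lambda>j. j + r) xs"
    by (intro sorted_distinct_set_unique)
      (auto simp: sorted_wrt_filter sorted_wrt_map distinct_map xs(2) inj_on_def)
  have agents: "pos D j = v" "pos C (j + r) = v + r" "j + r < k" if "j \<in> agents_at k D v" for j
    using shifted that by (auto simp: node_shifted_def agents_at_def)
  have "wb (fold (act n A ids (shift_link r m)) (map (\<lambda>j. j + r) xs) C) (v + r) =
      wb (fold (act n A ids' m) xs D) v \<and>
    (\<forall>j\<in>set xs. agent_shifted r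
      (fold (act n A ids (shift_link r m)) (map (\<lambda>j. j + r) xs) C)
      (fold (act n A ids' m) xs D) j)"
    using v shifted agents ids by (intro fold_act_shifted) (auto simp: node_shifted_def xs)
  then show "wb C' (v + r) = wb D' v" and "j \<in> agents_at k D v \<Longrightarrow> agent_shifted r C' D' j"
    using agents fold_act_local[where xs = "[0..<k]" and C = C and v = "v + r", unfolded filter_C]
      fold_act_local[where xs = "[0..<k]" and C = D and v = v, folded xs_def]
    by (simp_all add: C'_def D'_def agent_shifted_def xs)
qed

lemma round_node_shifted:
  fixes n A ids ids' m r k C D
  defines "C' \<equiv> full_round n k A ids (shift_link r m) C"
    and "D' \<equiv> full_round n k A ids' m D"
  assumes w: "1 < w" "w + r + 2 < n"
    and shifted: "\<And>v. \<lbrakk>w \<le> v + 1; v \<le> w + 1\<rbrakk> \<Longrightarrow> node_shifted k r C D v"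
    and ids: "\<forall>j. j + r < k \<longrightarrow> ids (j + r) = ids' j"
    and less: "\<And>j. j < k \<Longrightarrow> pos C j < n \<and> pos D j < n"
  shows "node_shifted k r C' D' w"
proof -
  have agent: "agent_shifted r C' D' j" if "w \<le> v + 1" "v \<le> w + 1" "j \<in> agents_at k D v" for v j
    unfolding C'_def D'_def using that w shifted ids by (intro round_shifted(2)[of v]) auto
  have origin_C: "\<exists>j<k. a = j + r \<and> pos D' j = w" if "a < k" "pos C' a = w + r" for a
  proof -
    define v where "v = pos C a - r"
    have "w + r \<le> pos C a + 1" "pos C a \<le> w + r + 1"
      using pos_fold_act_interior[of "[0..<k]" C a n A ids "shift_link r m", folded C'_def]
        that less w by auto
    then have v: "w \<le> v + 1" "v \<le> w + 1" "pos C a = v + r" using w by (auto simp: v_def)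
    then have "a \<in> agents_at k C (v + r)" using that(1) by (simp add: agents_at_def)
    then obtain j where "j \<in> agents_at k D v" "a = j + r"
      using shifted[OF v(1,2)] by (auto simp: node_shifted_def)
    then show ?thesis using agent[OF v(1,2)] that(2) by (auto simp: agents_at_def agent_shifted_def)
  qed
  have origin_D: "j + r < k" "agent_shifted r C' D' j" if "j < k" "pos D' j = w" for j
  proof -
    have v: "w \<le> pos D j + 1" "pos D j \<le> w + 1"
      using pos_fold_act_interior[of "[0..<k]" D j n A ids' m, folded D'_def] that less w by auto
    moreover have "j \<in> agents_at k D (pos D j)" using that(1) by (simp add: agents_at_def)
    ultimately show "j + r < k" "agent_shifted r C' D' j"
      using agent shifted[OF v] by (auto simp: node_shifted_def agents_at_def)
  qed
  have "agents_at k C' (w + r) = (\<lambda>j. j + r) ` agents_at k D' w"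
    using origin_C origin_D unfolding agents_at_def agent_shifted_def by fastforce
  moreover have "wb C' (w + r) = wb D' w"
    unfolding C'_def D'_def using w shifted ids by (intro round_shifted(1)) auto
  ultimately show ?thesis
    using origin_D(2) by (auto simp: node_shifted_def agents_at_def)
qed

section \<open>Runs from consecutive nodes\<close>

abbreviation packed_run ::
  "nat \<Rightarrow> nat \<Rightarrow> ('s, 'w) algorithm \<Rightarrow> (nat \<Rightarrow> nat) \<Rightarrow> nat \<Rightarrow> ('s, 'w) config" where
  "packed_run n k A ids \<equiv> config_at n k A (\<lambda>a. a) ids (lossless_schedule k)"

lemma packed_run_Suc:
  "packed_run n k A ids (Suc t) = full_round n k A ids None (packed_run n k A ids t)"
  by (simp add: lossless_schedule_def)

lemma packed_run_shifted:
  assumes "\<forall>j. j + r < k \<longrightarrow> ids (j + r) = ids' j" "k \<le> n" "t < v" "v + r + t + 1 < k"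
  shows "node_shifted k r (packed_run n k A ids t) (packed_run n k A ids' t) v"
  using assms(3,4)
proof (induction t arbitrary: v)
  case 0
  then show ?case
    by (auto simp: node_shifted_def agents_at_def agent_shifted_def init_config_def)
next
  case (Suc t)
  have "pos (packed_run n k A ids'' t) j < n" if "j < k" for ids'' j
    using that assms(2) by (intro pos_config_at_less) auto
  then show ?case
    unfolding packed_run_Suc using Suc assms(1,2)
    by (intro round_node_shifted[where m = None, unfolded option.map]) auto
qed

lemma pos_packed_run_shift:
  assumes "\<forall>j. j + r < k \<longrightarrow> ids (j + r) = ids' j" "k \<le> n" "2 * t < j" "j + r + 2 * t + 1 < k"
  shows "pos (packed_run n k A ids t) (j + r) = pos (packed_run n k A ids' t) j + r"
proof -
  define v where "v = pos (packed_run n k A ids' t) j"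
  have "v < n" "ring_dist n j v \<le> int t"
    using pos_config_at_less[of n k "lossless_schedule k" "\<lambda>a. a" j A ids' t]
      ring_dist_config_at[of n k "lossless_schedule k" "\<lambda>a. a" j A ids' t] assms
    by (auto simp: v_def)
  then have "v \<le> j + t" "j \<le> v + t"
    using ring_dist_interior[of n j v t] assms by auto
  then have "node_shifted k r (packed_run n k A ids t) (packed_run n k A ids' t) v"
    using assms by (intro packed_run_shifted) auto
  moreover have "j \<in> agents_at k (packed_run n k A ids' t) v"
    using assms(4) by (simp add: agents_at_def v_def)
  ultimately show ?thesis by (auto simp: node_shifted_def agent_shifted_def)
qed

section \<open>Identifiers that cannot be told apart\<close>

lemma Ramsey_strict_mono:
  fixes P :: "(nat \<Rightarrow> nat) \<Rightarrow> 'c"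
  assumes finite: "finite (range P)" and cong: "\<And>f g. (\<And>i. i < k \<Longrightarrow> f i = g i) \<Longrightarrow> P f = P g"
  obtains h :: "nat \<Rightarrow> nat" where "strict_mono h" "\<And>f. strict_mono f \<Longrightarrow> P (h \<circ> f) = P h"
proof -
  obtain index where index: "bij_betw index (range P) {0..<card (range P)}"
    using finite ex_bij_betw_finite_nat by blast
  define colour where "colour X = index (P ((!) (sorted_list_of_set X)))" for X
  have "colour X < card (range P)" for X
    using bij_betwE[OF index] by (simp add: colour_def)
  then obtain Y q where Y: "infinite Y" "\<And>X. \<lbrakk>X \<subseteq> Y; finite X; card X = k\<rbrakk> \<Longrightarrow> colour X = q"
    using Ramsey[of UNIV k colour "card (range P)"] by auto
  have colour_P: "index (P f) = q" if "strict_mono f" "range f \<subseteq> Y" for f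
  proof -
    have "inj f" using that(1) by (rule strict_mono_imp_inj_on)
    have "sorted (map f [0..<k])" "distinct (map f [0..<k])"
      using that(1) \<open>inj f\<close>
      by (auto simp: sorted_iff_nth_mono strict_mono_less_eq distinct_map intro: inj_on_subset)
    then have "sorted_list_of_set (set (map f [0..<k])) = map f [0..<k]"
      by (rule sorted_list_of_set.idem_if_sorted_distinct)
    then have "P f = P ((!) (sorted_list_of_set (f ` {..<k})))"
      by (intro cong) (simp add: atLeast0LessThan)
    moreover have "card (f ` {..<k}) = k"
      using \<open>inj f\<close> by (simp add: card_image inj_on_subset)
    ultimately show ?thesis
      using Y(2)[of "f ` {..<k}"] that(2) by (auto simp: colour_def)
  qed
  have "P (enumerate Y \<circ> f) = P (enumerate Y)" if "strict_mono f" for f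
  proof -
    have "strict_mono (enumerate Y)" "strict_mono (enumerate Y \<circ> f)"
      using Y(1) that by (auto intro: strict_mono_enumerate strict_mono_o)
    then have "index (P (enumerate Y \<circ> f)) = index (P (enumerate Y))"
      using Y(1) by (simp add: colour_P enumerate_in_set image_subset_iff)
    then show ?thesis using index by (auto simp: bij_betw_def dest: inj_onD)
  qed
  then show ?thesis using that strict_mono_enumerate Y(1) by blast
qed

lemma homogeneous_identifiers:
  fixes A :: "('s, 'w) algorithm"
  assumes "valid_schedule n k \<sigma>" "start ` {..<k} \<subseteq> {..<n}"
  obtains h :: "nat \<Rightarrow> nat" where "strict_mono h"
    "\<And>f a. \<lbrakk>strict_mono f; a < k\<rbrakk> \<Longrightarrow>
      pos (config_at n k A start (h \<circ> f) \<sigma> t) a = pos (config_at n k A start h \<sigma> t) a"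
proof -
  define P where "P ids = map (pos (config_at n k A start ids \<sigma> t)) [0..<k]" for ids
  have "range P \<subseteq> {xs. set xs \<subseteq> {..<n} \<and> length xs = k}"
    using pos_config_at_less[OF assms(1)] assms(2) by (fastforce simp: P_def)
  then have "finite (range P)" by (rule finite_subset) (simp add: finite_lists_length_eq)
  moreover have "P ids = P ids'" if "\<And>i. i < k \<Longrightarrow> ids i = ids' i" for ids ids'
    by (simp add: P_def config_at_ids_cong[OF assms(1) that])
  ultimately obtain h where h: "strict_mono h" "\<And>f. strict_mono f \<Longrightarrow> P (h \<circ> f) = P h"
    using Ramsey_strict_mono by blast
  show ?thesis
  proof (rule that[OF h(1)])
    fix f :: "nat \<Rightarrow> nat" and a
    assume "strict_mono f" "a < k"
    then show "pos (config_at n k A start (h \<circ> f) \<sigma> t) a = pos (config_at n k A start h \<sigma> t) a"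
      using h(2)[of f] by (simp add: P_def)
  qed
qed

lemma packed_run_uniform_displacement:
  fixes A :: "('s, 'w) algorithm"
  assumes "k \<le> n"
  obtains h :: "nat \<Rightarrow> nat" where "strict_mono h"
    "\<And>j r. \<lbrakk>2 * t < j; j + r + 2 * t + 1 < k\<rbrakk> \<Longrightarrow>
      pos (packed_run n k A h t) (j + r) = pos (packed_run n k A h t) j + r"
proof -
  have "(\<lambda>a. a) ` {..<k} \<subseteq> {..<n}" using assms by auto
  then obtain h :: "nat \<Rightarrow> nat" where h: "strict_mono h"
    "\<And>f a. \<lbrakk>strict_mono f; a < k\<rbrakk> \<Longrightarrow>
      pos (packed_run n k A (h \<circ> f) t) a = pos (packed_run n k A h t) a"
    using homogeneous_identifiers valid_lossless_schedule by metis
  have "pos (packed_run n k A h t) (j + r) = pos (packed_run n k A h t) j + r"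
    if "2 * t < j" "j + r + 2 * t + 1 < k" for j r
  proof -
    have "pos (packed_run n k A h t) (j + r) =
        pos (packed_run n k A (h \<circ> (\<lambda>i. i + r)) t) j + r"
      using that assms by (intro pos_packed_run_shift) auto
    moreover have "strict_mono (\<lambda>i. i + r)" by (simp add: strict_mono_def)
    ultimately show ?thesis using h(2) that(2) by simp
  qed
  then show ?thesis using that h(1) by blast
qed

lemma agents_le_time:
  assumes "solves_partial_gathering g n k A" "1 < g" "time_complexity n k A \<le> enat T" "k \<le> n"
  shows "k \<le> 8 * T + 2"
proof (rule ccontr)
  assume "\<not> k \<le> 8 * T + 2"
  then have large: "8 * T + 2 < k" by simp
  obtain h :: "nat \<Rightarrow> nat" where h: "strict_mono h"
    and displaced: "\<And>j r. \<lbrakk>2 * T < j; j + r + 2 * T + 1 < k\<rbrakk> \<Longrightarrow>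
      pos (packed_run n k A h T) (j + r) = pos (packed_run n k A h T) j + r"
    using packed_run_uniform_displacement assms(4) by blast
  define middle where "middle = 4 * T + 1"
  have "inj h" using h by (rule strict_mono_imp_inj_on)
  then have "(\<lambda>a. a, h, lossless_schedule k) \<in> scenarios n k"
    using assms(4) by (auto simp: scenarios_def intro: inj_on_subset)
  then obtain b where b: "b \<noteq> middle" "ring_dist n middle b \<le> 2 * int T" "b < k"
    and meet: "pos (packed_run n k A h T) b = pos (packed_run n k A h T) middle"
    using agent_meets_nearby_agent[OF assms(1-3), of "\<lambda>a. a" h "lossless_schedule k" middle]
      large by (auto simp: middle_def)
  then have "2 * T < b" "b \<le> 6 * T + 1"
    using ring_dist_interior[of n middle b "2 * T"] large assms(4) by (auto simp: middle_def)
  then show False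
    using displaced[of middle "b - middle"] displaced[of b "middle - b"] meet b(1) large
    by (cases "b < middle") (auto simp: middle_def)
qed

theorem theorem2:
  shows "\<exists>c>0. \<exists>N. \<forall>n\<ge>N. \<forall>g k. \<forall>A :: (nat, nat) algorithm.
    1 < g \<and> g < k \<and> k \<le> n \<and> finite_automata A \<and> solves_partial_gathering g n k A \<longrightarrow>
    ereal (c * real n) \<le> ereal_of_enat (time_complexity n k A)"
proof (rule exI[of _ "1 / 14 :: real"], intro conjI exI[of _ "3 :: nat"] allI impI)
  fix n g k :: nat and A :: "(nat, nat) algorithm"
  assume "3 \<le> n"
    and "1 < g \<and> g < k \<and> k \<le> n \<and> finite_automata A \<and> solves_partial_gathering g n k A"
  then have A: "solves_partial_gathering g n k A" "1 < g" and k: "0 < k" "k \<le> n" by auto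
  show "ereal (1 / 14 * real n) \<le> ereal_of_enat (time_complexity n k A)"
  proof (cases "time_complexity n k A")
    case (enat T)
    have "n \<le> k + 4 * T" using A enat k(1) by (intro nodes_le_agents_plus_time) auto
    moreover have "k \<le> 8 * T + 2" using A enat k(2) by (intro agents_le_time) auto
    ultimately have "n \<le> 14 * T" using \<open>3 \<le> n\<close> by presburger
    then show ?thesis using enat by simp
  qed simp
qed simp

end
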